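(* Define $a(1)=1$ and $a(n)=1+\sum_m a(m)$ for $n>1$, and $b(1)=1$ and $b(n)=n+\sum_m b(m)$ for $n>1$, where in both cases the sum runs over all proper divisors $m$ of $n$ (positive divisors $m<n$). Let $A(n)=a(n)/n$ and $B(n)=b(n)/n$. Then for every positive integer $n$, $$B(n)=\frac12+\frac12\sum_{m\mid n}A(m),$$ the sum running over all positive divisors $m$ of $n$.
   Context: $a(n)$ is the number of recursive divisors and $b(n)$ the sum of recursive divisors of $n$. *)

theory Defs
  imports Complex_Main
begin

text \<open>
  For \<open>n > 0\<close> every divisor of \<open>n\<close> is positive, so \<open>{m. m dvd n \<and> m < n}\<close> is exactly the set of
  proper divisors of \<open>n\<close>. The values at \<open>0\<close> (\<open>1\<close> and \<open>0\<close>, respectively) are junk values, as the set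
  is then empty. The defining equations would loop as simplification rules, hence \<open>simp del\<close>.
\<close>

function num_recursive_divisors :: "nat \<Rightarrow> nat" where
  "num_recursive_divisors n =
     (if n = 1 then 1 else 1 + (\<Sum>m\<in>{m. m dvd n \<and> m < n}. num_recursive_divisors m))"
  by auto
termination by (relation "measure id") auto

function sum_recursive_divisors :: "nat \<Rightarrow> nat" where
  "sum_recursive_divisors n =
     (if n = 1 then 1 else n + (\<Sum>m\<in>{m. m dvd n \<and> m < n}. sum_recursive_divisors m))"
  by auto
termination by (relation "measure id") auto

declare num_recursive_divisors.simps [simp del] sum_recursive_divisors.simps [simp del]

definition A :: "nat \<Rightarrow> real" where
  "A n = real (num_recursive_divisors n) / real n"

definition B :: "nat \<Rightarrow> real" where
  "B n = real (sum_recursive_divisors n) / real n"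

end

theory Submission
  imports Defs
begin

text \<open>
  Including \<open>n\<close> itself in the divisor sums, both recursions hold uniformly for \<open>n > 0\<close>:
  \<open>2 a(n) = 1 + \<Sum>\<^bsub>d | n\<^esub> a(d)\<close> and \<open>2 b(n) = n + \<Sum>\<^bsub>d | n\<^esub> b(d)\<close>. Let \<open>S(n) = \<Sum>\<^bsub>m | n\<^esub> a(m) n/m\<close>.
  Interchanging sums and applying the recursion of \<open>a\<close> gives \<open>\<Sum>\<^bsub>d | n\<^esub> S(d) = 2 S(n) - \<sigma>(n)\<close>, so that
  \<open>n + S(n)\<close> satisfies the same recursion as \<open>2 b(n)\<close>. Dividing \<open>2 b(n) = n + S(n)\<close> by \<open>2 n\<close>
  yields the claim.
\<close>

lemma sum_divisors_split:
  fixes f :: "nat \<Rightarrow> 'a :: comm_monoid_add"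
  assumes "n > 0"
  shows "(\<Sum>m | m dvd n. f m) = f n + (\<Sum>m | m dvd n \<and> m < n. f m)"
proof -
  have "{m. m dvd n} = insert n {m. m dvd n \<and> m < n}"
    using assms by (auto dest: dvd_imp_le)
  then show ?thesis
    by simp
qed

lemma sum_divisors_flip:
  fixes f :: "nat \<Rightarrow> 'a :: comm_monoid_add"
  assumes "n > 0"
  shows "(\<Sum>k | k dvd n. f (n div k)) = (\<Sum>m | m dvd n. f m)"
  by (rule sum.reindex_bij_witness[of _ "\<lambda>m. n div m" "\<lambda>k. n div k"]) (use assms in auto)

text \<open>Substitute \<open>d = k * m\<close>: pairs with \<open>m dvd d\<close> and
  \<open>d dvd n\<close> correspond to pairs with \<open>k dvd n\<close> and
  \<open>m dvd n div k\<close>.\<close>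

lemma sum_divisors_nested:
  fixes f :: "nat \<Rightarrow> nat \<Rightarrow> 'a :: comm_monoid_add"
  assumes "n > 0"
  shows "(\<Sum>d | d dvd n. \<Sum>m | m dvd d. f m (d div m)) = (\<Sum>k | k dvd n. \<Sum>m | m dvd n div k. f m k)"
proof -
  \<comment> \<open>A divisor of \<open>n > 0\<close> is nonzero, whereas \<open>0\<close> has
    infinitely many divisors.\<close>
  have fin: "finite {d. d dvd k}" if "k dvd n" for k
    using assms that by (intro finite_divisors_nat) (auto intro: Nat.gr0I)
  have "(\<Sum>d | d dvd n. \<Sum>m | m dvd d. f m (d div m)) =
        (\<Sum>(d, m)\<in>(SIGMA d:{d. d dvd n}. {m. m dvd d}). f m (d div m))"
    by (rule sum.Sigma) (use fin in auto)
  also have "\<dots> = (\<Sum>(k, m)\<in>(SIGMA k:{k. k dvd n}. {m. m dvd n div k}). f m k)"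
  proof (rule sum.reindex_bij_witness[of _ "\<lambda>(k, m). (k * m, m)" "\<lambda>(d, m). (d div m, m)"])
  qed (use assms in \<open>auto elim!: dvdE\<close>)
  also have "\<dots> = (\<Sum>k | k dvd n. \<Sum>m | m dvd n div k. f m k)"
    by (rule sum.Sigma[symmetric]) (use fin in \<open>auto simp: div_dvd_iff_mult\<close>)
  finally show ?thesis .
qed

lemma num_recursive_divisors_double:
  assumes "n > 0"
  shows "2 * num_recursive_divisors n = 1 + (\<Sum>m | m dvd n. num_recursive_divisors m)"
  using num_recursive_divisors.simps[of n] sum_divisors_split[OF assms, of num_recursive_divisors]
  by (cases "n = 1") auto

lemma sum_recursive_divisors_double:
  assumes "n > 0"
  shows "2 * sum_recursive_divisors n =
    n + (\<Sum>m | m dvd n. num_recursive_divisors m * (n div m))"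
  using assms
proof (induction n rule: less_induct)
  case (less n)
  define S where "S n = (\<Sum>m | m dvd n. num_recursive_divisors m * (n div m))" for n
  have "(\<Sum>d | d dvd n. S d) = (\<Sum>k | k dvd n. \<Sum>m | m dvd n div k. num_recursive_divisors m * k)"
    unfolding S_def by (rule sum_divisors_nested) (fact less.prems)
  then have "(\<Sum>d | d dvd n. d + S d) =
      (\<Sum>k | k dvd n. k * (1 + (\<Sum>m | m dvd n div k. num_recursive_divisors m)))"
    by (simp add: sum.distrib sum_distrib_left algebra_simps)
  also have "\<dots> = (\<Sum>k | k dvd n. k * (2 * num_recursive_divisors (n div k)))"
    using less.prems
    by (intro sum.cong refl arg_cong2[where f = "(*)"] num_recursive_divisors_double[symmetric])
      (auto simp: div_greater_zero_iff dest: dvd_imp_le dvd_pos_nat)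
  \<comment> \<open>As \<open>k = n div (n div k)\<close> for \<open>k dvd n\<close>, each summand
    becomes a function of \<open>n div k\<close> alone, ready for the flip.\<close>
  also have "\<dots> = (\<Sum>k | k dvd n. 2 * (num_recursive_divisors (n div k) * (n div (n div k))))"
    using less.prems by (intro sum.cong) auto
  also have "\<dots> = 2 * S n"
    unfolding S_def sum_distrib_left using less.prems by (rule sum_divisors_flip)
  finally have sum_S: "(\<Sum>d | d dvd n. d + S d) = 2 * S n" .
  \<comment> \<open>The left side is twice the defining recursion of
    \<open>sum_recursive_divisors n\<close>; the induction hypothesis rewrites its terms at proper
    divisors.\<close>
  have "2 * n + (\<Sum>d | d dvd n \<and> d < n. 2 * sum_recursive_divisors d) =
      2 * n + (\<Sum>d | d dvd n \<and> d < n. d + S d)"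
    using less by (intro arg_cong2[where f = "(+)"] sum.cong) (auto simp: S_def dest: dvd_pos_nat)
  also have "\<dots> = n + S n"
    using sum_S sum_divisors_split[OF less.prems, of "\<lambda>d. d + S d"] by simp
  finally show ?case
    using sum_recursive_divisors.simps[of n] num_recursive_divisors.simps[of 1]
    by (cases "n = 1") (auto simp: S_def sum_distrib_left)
qed

theorem theorem2:
  fixes n :: nat
  assumes "n > 0"
  shows "B n = 1 / 2 + 1 / 2 * (\<Sum>m\<in>{m. m dvd n}. A m)"
proof -
  have "real n * (\<Sum>m | m dvd n. A m) =
      real (\<Sum>m | m dvd n. num_recursive_divisors m * (n div m))"
    unfolding sum_distrib_left of_nat_sum
    by (intro sum.cong) (auto simp: A_def real_of_nat_div)
  then have "2 * real (sum_recursive_divisors n) = real n + real n * (\<Sum>m | m dvd n. A m)"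
    using sum_recursive_divisors_double[OF assms] by linarith
  then show ?thesis
    using assms by (simp add: B_def field_simps)
qed

end
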